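(* Let $\beta,n\ge 2$ be integers, let $x_0=0$, $x_n=1$, let $0<x_1<\cdots<x_{n-1}<1$ be real numbers each of which is rational or belongs to $S_{\beta,n}$, and let $\alpha_1,\alpha_2,\ldots,\alpha_n$ be elements of $\{1,2,\ldots,\beta\}$. Let $f:[0,1)\to[0,1)$ be the map defined by $$f(x)=\frac1\beta x+\frac{\alpha_i-1}{\beta}\quad\text{for all } x\in[x_{i-1},x_i)\text{ and } 1\le i\le n.$$ Then the global attractor $\omega(f)$ of $f$ is finite.
   Context: Let $I=[0,1)$. For a map $f:I\to I$, the $\omega$-limit set (global attractor) of $f$ is $$\omega(f)=\bigcup_{x\in I}\omega(x,f),\qquad \omega(x,f)=\bigcap_{r\ge 0}\overline{\bigcup_{k\ge r}\{f^k(x)\}},$$ where $f^k$ is the $k$-th iterate of $f$ and closures are taken in $[0,1]$. For an infinite word $w=w_0w_1w_2\ldots$ over a finite alphabet and a positive integer $k$, let $L_k(w)=\{w_iw_{i+1}\ldots w_{i+k-1}: i\ge 0\}$ be the set of factors of $w$ of length $k$, and let $p_w(k)=\#L_k(w)$ be its cardinality. For integers $\beta,n\ge 2$, let $\mathcal{A}=\{0,1,\ldots,\beta-1\}$, and for $w\in\mathcal{A}^{\mathbb{N}}$ let $\varphi(w)=\sum_{i=0}^\infty w_i\beta^{-(i+1)}\in[0,1]$. Let $$\ell=\min\{k\in\mathbb{N}: 2\beta^{-k}<(1-\beta^{-1})/(n+1)\}$$ and $$S_{\beta,n}=\{\varphi(w): w\in\mathcal{A}^{\mathbb{N}}\text{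 and } p_w(\ell)=\beta^{\ell}\}.$$ *)

theory Defs
  imports "HOL-Analysis.Analysis"
begin

text \<open>A map of \<open>[0,1)\<close> into itself is rendered as a function \<open>f :: real \<Rightarrow> real\<close> that preserves
  \<open>{0..<1}\<close>; its values outside play no role, as only orbits of points of \<open>{0..<1}\<close> are used.
  Since these orbits lie in \<open>[0,1]\<close>, which is closed, the closure in \<open>[0,1]\<close> is the closure
  in the reals.\<close>

definition omega_limit :: "(real \<Rightarrow> real) \<Rightarrow> real \<Rightarrow> real set" where
  "omega_limit f x = (\<Inter>r::nat. closure (\<Union>k\<in>{r..}. {(f ^^ k) x}))"

definition global_attractor :: "(real \<Rightarrow> real) \<Rightarrow> real set" where
  "global_attractor f = (\<Union>x\<in>{0..<1}. omega_limit f x)"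

definition factors :: "(nat \<Rightarrow> 'a) \<Rightarrow> nat \<Rightarrow> 'a list set" where
  "factors w k = {map w [i..<i + k] | i. True}"

text \<open>The cardinality is the true one for words over a finite alphabet, where
  \<open>factors w k\<close> is finite.\<close>

definition complexity :: "(nat \<Rightarrow> 'a) \<Rightarrow> nat \<Rightarrow> nat" where
  "complexity w k = card (factors w k)"

definition words :: "nat \<Rightarrow> (nat \<Rightarrow> nat) set" where
  "words \<beta> = {w. \<forall>i. w i \<in> {0..<\<beta>}}"

definition phi :: "nat \<Rightarrow> (nat \<Rightarrow> nat) \<Rightarrow> real" where
  "phi \<beta> w = (\<Sum>i. real (w i) / real \<beta> ^ (i + 1))"

text \<open>For \<open>\<beta> \<ge> 2\<close> the minimum exists, and \<open>k = 0\<close> never satisfies the inequality, so it does not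
  matter whether the natural numbers start at \<open>0\<close> or at \<open>1\<close>.\<close>

definition ell :: "nat \<Rightarrow> nat \<Rightarrow> nat" where
  "ell \<beta> n = (LEAST k. 2 / real \<beta> ^ k < (1 - 1 / real \<beta>) / (real n + 1))"

definition S :: "nat \<Rightarrow> nat \<Rightarrow> real set" where
  "S \<beta> n = {phi \<beta> w | w. w \<in> words \<beta> \<and> complexity w (ell \<beta> n) = \<beta> ^ ell \<beta> n}"

end

theory Submission
  imports Defs
begin

text \<open>The map \<open>f\<close> prepends a digit to the base-\<open>\<beta>\<close> expansion, so the digit shift
  \<open>T t = frac (\<beta> * t)\<close> is a left inverse of \<open>f\<close>, and a breakpoint has at most one preimage
  under \<open>f\<^sup>k\<close>, namely its image under \<open>T\<^sup>k\<close>. The backward orbit of every breakpoint is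
  finite: a rational point has a finite \<open>T\<close>-orbit, while the \<open>T\<close>-orbit of an irrational point of
  \<open>S\<close> visits every cylinder of length \<open>ell\<close>, in particular one that the image of \<open>f\<close>, of total
  length \<open>1/\<beta>\<close> in \<open>n\<close> intervals, does not meet. The finite union \<open>Q\<close> of these backward orbits cuts
  \<open>[0,1)\<close> into finitely many intervals, each of which \<open>f\<close> contracts affinely into another one. Hence
  every orbit is attracted by one of finitely many cycles.\<close>

section \<open>Maps contracting a finite partition\<close>

lemma omega_limit_iff:
  "z \<in> omega_limit f x \<longleftrightarrow> (\<forall>r. \<forall>e>0. \<exists>k\<ge>r. dist ((f ^^ k) x) z < e)"
proof -
  have "(\<exists>y\<in>(\<Union>k\<in>{r..}. {(f ^^ k) x}). dist y z < e) \<longleftrightarrow> (\<exists>k\<ge>r. dist ((f ^^ k) x) z < e)" for r e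
    by auto
  then show ?thesis unfolding omega_limit_def closure_approachable INT_iff by simp
qed

text \<open>Once the two orbits are close, an iterate of \<open>x\<close> near \<open>z\<close>
  brings the iterate of \<open>y\<close> with the same index near \<open>z\<close>. One point can
  thus stand for all points asymptotic to it.\<close>

lemma omega_limit_subset_if_asymptotic:
  assumes "(\<lambda>k. dist ((f ^^ k) x) ((f ^^ k) y)) \<longlonglongrightarrow> 0"
  shows "omega_limit f x \<subseteq> omega_limit f y"
proof
  fix z assume z: "z \<in> omega_limit f x"
  show "z \<in> omega_limit f y"
    unfolding omega_limit_iff
  proof (intro allI impI)
    fix r :: nat and e :: real assume e: "e > 0"
    obtain N where N: "\<And>k. k \<ge> N \<Longrightarrow> dist ((f ^^ k) x) ((f ^^ k) y) < e / 2"
      using order_tendstoD(2)[OF assms half_gt_zero[OF e]] unfolding eventually_sequentially by blast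
    from z half_gt_zero[OF e] obtain k where k: "k \<ge> max r N" "dist ((f ^^ k) x) z < e / 2"
      unfolding omega_limit_iff by blast
    have "dist ((f ^^ k) y) z \<le> dist ((f ^^ k) x) ((f ^^ k) y) + dist ((f ^^ k) x) z"
      by (rule dist_triangle3)
    also have "\<dots> < e" using N[of k] k by simp
    finally show "\<exists>k\<ge>r. dist ((f ^^ k) y) z < e" using k(1) by auto
  qed
qed

text \<open>Limit points are approached at arbitrarily late times, so dropping the first
  \<open>a\<close> iterates loses none. The inclusion alone is enough to transfer
  finiteness.\<close>

lemma omega_limit_funpow_shift: "omega_limit f x \<subseteq> omega_limit f ((f ^^ a) x)"
proof
  fix z assume z: "z \<in> omega_limit f x"
  show "z \<in> omega_limit f ((f ^^ a) x)"
    unfolding omega_limit_iff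
  proof (intro allI impI)
    fix r :: nat and e :: real assume "e > 0"
    with z obtain k where k: "k \<ge> r + a" "dist ((f ^^ k) x) z < e"
      unfolding omega_limit_iff by blast
    have "(f ^^ (k - a)) ((f ^^ a) x) = (f ^^ k) x"
      using k(1) funpow_add[of "k - a" a f] by simp
    with k show "\<exists>k\<ge>r. dist ((f ^^ k) ((f ^^ a) x)) z < e"
      by (intro exI[of _ "k - a"]) auto
  qed
qed

text \<open>Every time \<open>k\<close> splits as \<open>k mod p + p * (k div p)\<close>, so at late
  times the orbit is close to one of the \<open>p\<close> limits and cannot return near any other
  point.\<close>

lemma finite_omega_limit_if_convergent:
  assumes p: "p > 0" and L: "\<And>r. r < p \<Longrightarrow> (\<lambda>m. (f ^^ (r + p * m)) u) \<longlonglongrightarrow> L r"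
  shows "finite (omega_limit f u)"
proof (rule finite_subset)
  show "omega_limit f u \<subseteq> L ` {..<p}"
  proof (rule ccontr)
    assume "\<not> omega_limit f u \<subseteq> L ` {..<p}"
    then obtain z where z: "z \<in> omega_limit f u" "z \<notin> L ` {..<p}" by blast
    \<comment> \<open>\<open>d\<close> bounds the distance from \<open>z\<close> to every
      \<open>L r\<close> from below; a late iterate within \<open>d / 2\<close> of both
      \<open>z\<close> and some limit contradicts this.\<close>
    obtain d where d: "d > 0" "\<forall>y\<in>L ` {..<p}. y \<noteq> z \<longrightarrow> d \<le> dist z y"
      using finite_set_avoid[of "L ` {..<p}" z] by blast
    have "\<forall>r\<in>{..<p}. eventually (\<lambda>m. dist ((f ^^ (r + p * m)) u) (L r) < d / 2) sequentially"
      using tendstoD[OF L half_gt_zero[OF d(1)]] by blast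
    then have "eventually (\<lambda>m. \<forall>r\<in>{..<p}. dist ((f ^^ (r + p * m)) u) (L r) < d / 2) sequentially"
      by (simp add: eventually_ball_finite)
    then obtain M where M: "\<And>m r. m \<ge> M \<Longrightarrow> r < p \<Longrightarrow> dist ((f ^^ (r + p * m)) u) (L r) < d / 2"
      unfolding eventually_sequentially by auto
    from z(1) half_gt_zero[OF d(1)] obtain k where k: "k \<ge> p * M" "dist ((f ^^ k) u) z < d / 2"
      unfolding omega_limit_iff by blast
    have "M \<le> k div p" using k(1) p by (simp add: less_eq_div_iff_mult_less_eq mult.commute)
    then have "dist ((f ^^ (k mod p + p * (k div p))) u) (L (k mod p)) < d / 2"
      using p by (intro M mod_less_divisor)
    then have "dist ((f ^^ k) u) (L (k mod p)) < d / 2" by simp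
    moreover have "d \<le> dist z (L (k mod p))" using d(2) z(2) p by (metis imageI lessThan_iff mod_less_divisor)
    moreover have "dist z (L (k mod p)) \<le> dist ((f ^^ k) u) z + dist ((f ^^ k) u) (L (k mod p))"
      by (rule dist_triangle3)
    ultimately show False using k(2) by linarith
  qed
qed simp

text \<open>\<open>c\<close> labels the cells of a finite partition, and \<open>f\<close> maps each
  cell into a single one. Points with one label keep equal labels and have asymptotic orbits, so one
  omega-limit set per label covers the attractor. By pigeonhole the labels along an orbit repeat,
  and from then on the orbit converges along residues modulo the time between the
  repetitions.\<close>

lemma finite_global_attractor_if_classes:
  fixes c :: "real \<Rightarrow> 'b" and f :: "real \<Rightarrow> real"
  assumes maps: "\<And>t. t \<in> {0..<1} \<Longrightarrow> f t \<in> {0..<1}"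
    and fin: "finite (c ` {0..<1})"
    and r: "0 \<le> r" "r < 1"
    and cls: "\<And>t u. t \<in> {0..<1} \<Longrightarrow> u \<in> {0..<1} \<Longrightarrow> c t = c u \<Longrightarrow> c (f t) = c (f u)"
    and contr: "\<And>t u. t \<in> {0..<1} \<Longrightarrow> u \<in> {0..<1} \<Longrightarrow> c t = c u \<Longrightarrow>
                  dist (f t) (f u) \<le> r * dist t u"
  shows "finite (global_attractor f)"
proof -
  have it: "(f ^^ k) t \<in> {0..<1}" if "t \<in> {0..<1}" for t k
    using that maps by (induction k) auto
  have cd: "c ((f ^^ k) t) = c ((f ^^ k) u) \<and> dist ((f ^^ k) t) ((f ^^ k) u) \<le> r ^ k"
    if "t \<in> {0..<1}" "u \<in> {0..<1}" "c t = c u" for t u k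
  proof (induction k)
    \<comment> \<open>Two points of \<open>[0,1)\<close> are at distance at most 1.\<close>
    case 0
    then show ?case using that by (auto simp: dist_real_def)
  next
    case (Suc k)
    then have "dist (f ((f ^^ k) t)) (f ((f ^^ k) u)) \<le> r * dist ((f ^^ k) t) ((f ^^ k) u)"
      by (intro contr it that) simp
    also have "\<dots> \<le> r * r ^ k" using Suc r by (intro mult_left_mono) auto
    finally show ?case using cls[OF it[OF that(1)] it[OF that(2)]] Suc by simp
  qed
  have pow: "(\<lambda>k. r ^ k) \<longlonglongrightarrow> 0" using r by (simp add: LIMSEQ_realpow_zero)
  have sub: "omega_limit f t \<subseteq> omega_limit f u"
    if "t \<in> {0..<1}" "u \<in> {0..<1}" "c t = c u" for t u
  proof (rule omega_limit_subset_if_asymptotic, rule tendsto_sandwich[OF _ _ tendsto_const pow])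
    show "\<forall>\<^sub>F k in sequentially. dist ((f ^^ k) t) ((f ^^ k) u) \<le> r ^ k"
      using cd[OF that] by simp
  qed simp
  have each: "finite (omega_limit f t)" if t: "t \<in> {0..<1}" for t
  proof -
    have "range (\<lambda>k. c ((f ^^ k) t)) \<subseteq> c ` {0..<1}" using it[OF t] by blast
    then have "finite (range (\<lambda>k. c ((f ^^ k) t)))" using fin by (rule finite_subset)
    then have "\<not> inj (\<lambda>k. c ((f ^^ k) t))" using finite_imageD infinite_UNIV_nat by blast
    then obtain a b where "a \<noteq> b" "c ((f ^^ a) t) = c ((f ^^ b) t)"
      by (auto simp: inj_def)
    then obtain a b where ab: "a < b" "c ((f ^^ a) t) = c ((f ^^ b) t)"
      by (metis linorder_neqE_nat)
    define u where "u = (f ^^ a) t"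
    define p where "p = b - a"
    have p: "p > 0" using ab by (simp add: p_def)
    have fp: "(f ^^ p) u = (f ^^ b) t"
      using ab funpow_add[of p a f] by (simp add: p_def u_def)
    have u: "u \<in> {0..<1}" using it t by (simp add: u_def)
    \<comment> \<open>The points \<open>u\<close> and \<open>(f ^^ p) u\<close> have the same label,
      so \<open>cd\<close> applies to their orbits, which are one orbit read with delay
      \<open>p\<close>.\<close>
    have close: "dist ((f ^^ k) u) ((f ^^ (k + p)) u) \<le> r ^ k" for k
      using cd[OF u it[OF u, of p], of k] ab(2) fp by (simp add: funpow_add u_def)
    have "convergent (\<lambda>m. (f ^^ (i + p * m)) u)" for i
    proof -
      let ?g = "\<lambda>m. (f ^^ (i + p * m)) u"
      \<comment> \<open>The increments over steps of length \<open>p\<close> are dominated by a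
        geometric series, and \<open>?g\<close> is recovered from them by telescoping.\<close>
      have "summable (\<lambda>m. ?g (Suc m) - ?g m)"
      proof (rule summable_comparison_test'[of "\<lambda>m. r ^ m" 0])
        show "summable (\<lambda>m. r ^ m)" using r by (simp add: summable_geometric)
        show "norm (?g (Suc m) - ?g m) \<le> r ^ m" for m
        proof -
          have "norm (?g (Suc m) - ?g m) \<le> r ^ (i + p * m)"
            using close[of "i + p * m"] by (simp add: dist_real_def abs_minus_commute algebra_simps)
          also have "\<dots> \<le> r ^ m"
            using r p by (intro power_decreasing) (auto intro: trans_le_add2)
          finally show ?thesis .
        qed
      qed
      then have "convergent (\<lambda>m. \<Sum>j<m. ?g (Suc j) - ?g j)"
        by (simp add: summable_iff_convergent)
      then have "convergent (\<lambda>m. ?g m - ?g 0)"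
        by (subst (asm) sum_lessThan_telescope)
      from convergent_add[OF this convergent_const[of "?g 0"]] show ?thesis by simp
    qed
    then have "finite (omega_limit f u)"
      unfolding convergent_LIMSEQ_iff by (intro finite_omega_limit_if_convergent[OF p])
    with omega_limit_funpow_shift[of f t a] show ?thesis
      unfolding u_def by (rule finite_subset)
  qed
  have "global_attractor f \<subseteq> (\<Union>v\<in>c ` {0..<1}. omega_limit f (inv_into {0..<1} c v))"
    unfolding global_attractor_def
  proof (rule UN_least)
    fix t :: real assume t: "t \<in> {0..<1}"
    have "omega_limit f t \<subseteq> omega_limit f (inv_into {0..<1} c (c t))"
      using t by (intro sub inv_into_into f_inv_into_f[symmetric] imageI)
    with t show "omega_limit f t \<subseteq> (\<Union>v\<in>c ` {0..<1}. omega_limit f (inv_into {0..<1} c v))"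
      by blast
  qed
  moreover have "finite (\<Union>v\<in>c ` {0..<1}. omega_limit f (inv_into {0..<1} c v))"
    using fin by (intro finite_UN_I each inv_into_into)
  ultimately show ?thesis by (rule finite_subset)
qed

text \<open>Label each point by the part of \<open>Q\<close> at or below it. If some
  \<open>q\<close> in \<open>Q\<close> separated the images of two equally labelled points, the
  increasing affine branch between them would attain \<open>q\<close> at a point between the two,
  and backward invariance would put that point into \<open>Q\<close>.\<close>

lemma finite_global_attractor_if_backward_invariant:
  fixes f :: "real \<Rightarrow> real"
  assumes maps: "\<And>t. t \<in> {0..<1} \<Longrightarrow> f t \<in> {0..<1}"
    and fin: "finite Q"
    and bwd: "\<And>t. t \<in> {0..<1} \<Longrightarrow> f t \<in> Q \<Longrightarrow> t \<in> Q"
    and r: "0 < r" "r < 1"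
    and aff: "\<And>t u. 0 \<le> t \<Longrightarrow> t < u \<Longrightarrow> u < 1 \<Longrightarrow> {t<..u} \<inter> Q = {} \<Longrightarrow>
                \<exists>a. \<forall>z\<in>{t..u}. f z = r * z + a"
  shows "finite (global_attractor f)"
proof -
  \<comment> \<open>Including \<open>t\<close> itself makes the classes intervals closed on the left
    and open on the right, the shape of the pieces on which the map of the theorem is
    affine.\<close>
  define c where "c t = Q \<inter> {..t}" for t :: real
  have c_iff: "c t = c u \<longleftrightarrow> {t<..u} \<inter> Q = {}" if "t \<le> u" for t u
  proof -
    have cu: "c u = c t \<union> ({t<..u} \<inter> Q)" using that by (auto simp: c_def)
    have "c t \<inter> ({t<..u} \<inter> Q) = {}" by (auto simp: c_def)
    then show ?thesis unfolding cu by blast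
  qed
  have step: "c (f t) = c (f u) \<and> dist (f t) (f u) = r * dist t u"
    if tu: "0 \<le> t" "t < u" "u < 1" "c t = c u" for t u
  proof -
    have Q: "{t<..u} \<inter> Q = {}" using c_iff[of t u] tu by simp
    then obtain a where a: "\<And>z. z \<in> {t..u} \<Longrightarrow> f z = r * z + a"
      using aff[OF tu(1-3)] by blast
    have ft: "f t = r * t + a" and fu: "f u = r * u + a" using a tu by auto
    have le: "f t \<le> f u" using ft fu tu r by simp
    have "{f t<..f u} \<inter> Q = {}"
    proof (rule ccontr)
      assume "{f t<..f u} \<inter> Q \<noteq> {}"
      then obtain q where q: "f t < q" "q \<le> f u" "q \<in> Q" by auto
      define z where "z = (q - a) / r"
      have z: "t < z" "z \<le> u" using q ft fu r by (auto simp: z_def field_simps)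
      then have "f z = q" using a[of z] r by (simp add: z_def)
      then have "z \<in> Q" using bwd[of z] q z tu by simp
      with Q z show False by auto
    qed
    then have "c (f t) = c (f u)" using c_iff[OF le] by simp
    moreover have "dist (f t) (f u) = \<bar>r * (t - u)\<bar>"
      by (simp add: ft fu dist_real_def algebra_simps)
    ultimately show ?thesis using r by (simp add: abs_mult dist_real_def)
  qed
  have step': "c (f t) = c (f u) \<and> dist (f t) (f u) = r * dist t u"
    if "t \<in> {0..<1}" "u \<in> {0..<1}" "c t = c u" for t u
  proof (cases t u rule: linorder_cases)
    case less
    with step[of t u] that show ?thesis by simp
  next
    case greater
    with step[of u t] that show ?thesis by (simp add: dist_commute)
  qed simp
  show ?thesis
  proof (rule finite_global_attractor_if_classes[where c = c and r = r])
    have "c ` {0..<1} \<subseteq> Pow Q" by (auto simp: c_def)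
    then show "finite (c ` {0..<1})" by (rule finite_subset) (simp add: fin)
    show "dist (f t) (f u) \<le> r * dist t u" if "t \<in> {0..<1}" "u \<in> {0..<1}" "c t = c u" for t u
      using step'[OF that] by simp
    show "c (f t) = c (f u)" if "t \<in> {0..<1}" "u \<in> {0..<1}" "c t = c u" for t u
      using step'[OF that] by simp
  qed (rule maps less_imp_le[OF r(1)] r(2), assumption?)+
qed

section \<open>Base-\<open>\<beta>\<close> expansions\<close>

definition base_shift :: "nat \<Rightarrow> real \<Rightarrow> real" where
  "base_shift \<beta> t = frac (real \<beta> * t)"

text \<open>Multiplying by an integer and subtracting an integer keeps the denominator
  \<open>b\<close>, and every iterate after the start lies in \<open>[0,1)\<close>; only finitely
  many fractions qualify.\<close>

lemma funpow_base_shift_rational_finite: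
  assumes "q \<in> \<rat>"
  shows "finite (range (\<lambda>k. (base_shift \<beta> ^^ k) q))"
proof -
  from assms obtain a b :: int where ab: "b > 0" "q = of_int a / of_int b"
    by (metis Rats_cases')
  \<comment> \<open>\<open>q\<close> is listed separately because it may lie outside
    \<open>[0,1)\<close>.\<close>
  let ?F = "insert q ((\<lambda>m. of_int m / real_of_int b) ` {0..b})"
  have q: "of_int b * q \<in> \<int>" using ab by simp
  have int: "of_int b * (base_shift \<beta> ^^ k) q \<in> \<int>" for k
  proof (induction k)
    case (Suc k)
    have "of_int b * base_shift \<beta> t = of_int (int \<beta>) * (of_int b * t) - of_int (b * \<lfloor>real \<beta> * t\<rfloor>)" for t
      by (simp add: base_shift_def frac_def algebra_simps)
    moreover have "of_int (int \<beta>) * (of_int b * (base_shift \<beta> ^^ k) q) - of_int m \<in> \<int>" for m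
      by (rule Ints_diff[OF Ints_mult[OF Ints_of_int Suc] Ints_of_int])
    ultimately show ?case by simp
  qed (use q in simp)
  have "(base_shift \<beta> ^^ k) q \<in> ?F" for k
  proof (cases k)
    case (Suc k')
    let ?t = "(base_shift \<beta> ^^ k) q"
    obtain m where m: "of_int b * ?t = of_int m" using int[of k] by (auto elim: Ints_cases)
    have t: "0 \<le> ?t" "?t < 1" using Suc by (simp_all add: base_shift_def frac_lt_1)
    have "0 \<le> real_of_int m" "real_of_int m \<le> of_int b"
      using mult_left_mono[of 0 ?t "of_int b"] mult_left_mono[of ?t 1 "of_int b"] t ab(1)
      unfolding m by auto
    moreover have "?t = of_int m / of_int b" using m ab(1) by (simp add: field_simps)
    ultimately show ?thesis by auto
  qed simp
  then have "range (\<lambda>k. (base_shift \<beta> ^^ k) q) \<subseteq> ?F" by blast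
  then show ?thesis by (rule finite_subset) simp
qed

lemma words_shift: "w \<in> words \<beta> \<Longrightarrow> (\<lambda>i. w (i + k)) \<in> words \<beta>"
  by (simp add: words_def)

text \<open>This is the series of the word with all digits \<open>\<beta> - 1\<close>. It dominates
  the series of every word, which yields convergence and the bound
  \<open>phi \<beta> w \<le> 1\<close>.\<close>

lemma geometric_digits_sums:
  assumes "\<beta> \<ge> 2"
  shows "(\<lambda>i. real (\<beta> - 1) / real \<beta> ^ (i + 1)) sums 1"
proof -
  have "(\<lambda>i. (1 / real \<beta>) ^ i) sums (1 / (1 - 1 / real \<beta>))"
    using assms by (intro geometric_sums) auto
  then have "(\<lambda>i. real (\<beta> - 1) / real \<beta> * (1 / real \<beta>) ^ i)
      sums (real (\<beta> - 1) / real \<beta> * (1 / (1 - 1 / real \<beta>)))"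
    by (rule sums_mult)
  moreover have "real (\<beta> - 1) / real \<beta> * (1 / (1 - 1 / real \<beta>)) = 1"
    using assms by (simp add: field_simps of_nat_diff)
  ultimately show ?thesis using assms by (simp add: power_divide split: if_splits)
qed

context
  fixes \<beta> :: nat and w :: "nat \<Rightarrow> nat"
  assumes \<beta>: "\<beta> \<ge> 2" and w: "w \<in> words \<beta>"
begin

lemma digit_le: "real (w i) / real \<beta> ^ (i + 1) \<le> real (\<beta> - 1) / real \<beta> ^ (i + 1)"
proof -
  have "w i < \<beta>" using w by (simp add: words_def)
  then show ?thesis by (intro divide_right_mono) auto
qed

lemma summable_phi: "summable (\<lambda>i. real (w i) / real \<beta> ^ (i + 1))"
proof (rule summable_comparison_test'[OF sums_summable[OF geometric_digits_sums[OF \<beta>]]])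
  show "norm (real (w i) / real \<beta> ^ (i + 1)) \<le> real (\<beta> - 1) / real \<beta> ^ (i + 1)" for i
    using digit_le[of i] by simp
qed

lemma phi_nonneg: "0 \<le> phi \<beta> w"
  unfolding phi_def by (rule suminf_nonneg[OF summable_phi]) simp

lemma phi_le_1: "phi \<beta> w \<le> 1"
  using suminf_le[OF digit_le summable_phi] geometric_digits_sums[OF \<beta>]
  by (simp add: phi_def sums_iff)

lemma phi_unfold: "phi \<beta> w = (real (w 0) + phi \<beta> (\<lambda>i. w (i + 1))) / real \<beta>"
proof -
  have sh: "summable (\<lambda>i. real (w (i + 1)) / real \<beta> ^ (i + 1))"
    using summable_phi summable_mult[of "\<lambda>i. real (w (Suc i)) / real \<beta> ^ (Suc i + 1)" "real \<beta>"]
      summable_ignore_initial_segment[OF summable_phi, of 1] \<beta> by simp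
  have "phi \<beta> w = real (w 0) / real \<beta> + (\<Sum>i. real (w (i + 1)) / real \<beta> ^ (i + 1) / real \<beta>)"
    unfolding phi_def using suminf_split_head[OF summable_phi] by (simp add: field_simps)
  also have "(\<Sum>i. real (w (i + 1)) / real \<beta> ^ (i + 1) / real \<beta>)
      = phi \<beta> (\<lambda>i. w (i + 1)) / real \<beta>"
    unfolding phi_def using suminf_divide[OF sh] by simp
  finally show ?thesis by (simp add: add_divide_distrib)
qed

end

text \<open>Irrationality excludes a tail of digits \<open>\<beta> - 1\<close>, whose value \<open>1\<close> is not in the range of
  the shift.\<close>

lemma base_shift_phi:
  assumes \<beta>: "\<beta> \<ge> 2" and w: "w \<in> words \<beta>" and irr: "phi \<beta> w \<notin> \<rat>"
  shows "base_shift \<beta> (phi \<beta> w) = phi \<beta> (\<lambda>i. w (i + 1))"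
    and "phi \<beta> (\<lambda>i. w (i + 1)) \<notin> \<rat>"
proof -
  let ?s = "phi \<beta> (\<lambda>i. w (i + 1))"
  have eq: "phi \<beta> w = (real (w 0) + ?s) / real \<beta>" by (rule phi_unfold[OF \<beta> w])
  show irr': "?s \<notin> \<rat>" using irr eq by auto
  have "0 \<le> ?s" "?s \<le> 1"
    using phi_nonneg[OF \<beta> words_shift[OF w]] phi_le_1[OF \<beta> words_shift[OF w]] by blast+
  moreover have "?s \<noteq> 1" using irr' by auto
  ultimately have "frac ?s = ?s" by (simp add: frac_eq)
  moreover have "real \<beta> * phi \<beta> w = ?s + of_nat (w 0)" using eq \<beta> by (simp add: field_simps)
  ultimately show "base_shift \<beta> (phi \<beta> w) = ?s"
    unfolding base_shift_def by (simp add: frac_def)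
qed

lemma funpow_base_shift_phi:
  assumes \<beta>: "\<beta> \<ge> 2" and w: "w \<in> words \<beta>" and irr: "phi \<beta> w \<notin> \<rat>"
  shows "(base_shift \<beta> ^^ k) (phi \<beta> w) = phi \<beta> (\<lambda>i. w (i + k)) \<and> phi \<beta> (\<lambda>i. w (i + k)) \<notin> \<rat>"
proof (induction k)
  case (Suc k)
  then show ?case
    using base_shift_phi[OF \<beta> words_shift[OF w, of k]] by simp
qed (use irr in simp)

text \<open>\<open>v\<close> is the expansion of \<open>j\<close> in base \<beta> with
  \<open>l\<close> digits, leading zeros included, and a tail contributes between 0 and 1 units of
  the last place. Both ends of the cell are attained, the upper one by a tail of digits
  \<open>\<beta> - 1\<close>, hence the two weak inequalities.\<close>

lemma phi_cylinder:
  assumes \<beta>: "\<beta> \<ge> 2" and "j < \<beta> ^ l"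
  shows "\<exists>v. length v = l \<and> set v \<subseteq> {0..<\<beta>} \<and>
    (\<forall>w\<in>words \<beta>. (\<forall>i<l. w i = v ! i) \<longrightarrow>
       real j \<le> phi \<beta> w * real \<beta> ^ l \<and> phi \<beta> w * real \<beta> ^ l \<le> real j + 1)"
  using assms(2)
proof (induction l arbitrary: j)
  case 0
  then show ?case using phi_nonneg[OF \<beta>] phi_le_1[OF \<beta>] by simp
next
  case (Suc l)
  let ?d = "j div \<beta> ^ l" and ?m = "j mod \<beta> ^ l"
  have "?m < \<beta> ^ l" using \<beta> by simp
  then obtain v where v: "length v = l" "set v \<subseteq> {0..<\<beta>}"
    "\<And>w. w \<in> words \<beta> \<Longrightarrow> \<forall>i<l. w i = v ! i \<Longrightarrow>
       real ?m \<le> phi \<beta> w * real \<beta> ^ l \<and> phi \<beta> w * real \<beta> ^ l \<le> real ?m + 1"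
    using Suc.IH by meson
  have d: "?d < \<beta>" using Suc.prems by (simp add: less_mult_imp_div_less)
  have j: "real j = real ?d * real \<beta> ^ l + real ?m"
    by (metis div_mult_mod_eq of_nat_add of_nat_mult of_nat_power)
  show ?case
  proof (intro exI[of _ "?d # v"] conjI ballI impI)
    fix w assume w: "w \<in> words \<beta>" and eq: "\<forall>i<Suc l. w i = (?d # v) ! i"
    let ?s = "phi \<beta> (\<lambda>i. w (i + 1))"
    have "real ?m \<le> ?s * real \<beta> ^ l \<and> ?s * real \<beta> ^ l \<le> real ?m + 1"
      using v(3)[OF words_shift[OF w, of 1]] eq by auto
    moreover have "phi \<beta> w * real \<beta> ^ Suc l = real ?d * real \<beta> ^ l + ?s * real \<beta> ^ l"
    proof -
      have "w 0 = ?d" using eq by simp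
      then have "phi \<beta> w * real \<beta> = real ?d + ?s" using phi_unfold[OF \<beta> w] \<beta> by simp
      then have "phi \<beta> w * real \<beta> * real \<beta> ^ l = (real ?d + ?s) * real \<beta> ^ l" by simp
      then show ?thesis by (simp add: algebra_simps)
    qed
    ultimately show "real j \<le> phi \<beta> w * real \<beta> ^ Suc l" "phi \<beta> w * real \<beta> ^ Suc l \<le> real j + 1"
      using j by linarith+
  qed (use v d in auto)
qed

text \<open>Only \<open>\<beta> ^ l\<close> words of length \<open>l\<close> exist over the
  alphabet, so full complexity leaves none out.\<close>

lemma factors_full:
  assumes w: "w \<in> words \<beta>" and compl: "complexity w l = \<beta> ^ l"
  shows "factors w l = {v. set v \<subseteq> {0..<\<beta>} \<and> length v = l}"
proof (rule card_subset_eq)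
  show "finite {v. set v \<subseteq> {0..<\<beta>} \<and> length v = l}" by (rule finite_lists_length_eq) simp
  show "factors w l \<subseteq> {v. set v \<subseteq> {0..<\<beta>} \<and> length v = l}"
    using w by (auto simp: factors_def words_def)
  show "card (factors w l) = card {v. set v \<subseteq> {0..<\<beta>} \<and> length v = l}"
    using compl by (simp add: complexity_def card_lists_length_eq)
qed

text \<open>The digits of \<open>j\<close> occur in \<open>w\<close> at some position
  \<open>k\<close>; shifting by \<open>k\<close> brings them to the front. Irrationality ensures
  that \<open>base_shift\<close> acts on the value as the shift acts on the word.\<close>

lemma shift_visits_cylinder:
  assumes \<beta>: "\<beta> \<ge> 2" and w: "w \<in> words \<beta>" and irr: "phi \<beta> w \<notin> \<rat>"
    and compl: "complexity w l = \<beta> ^ l" and j: "j < \<beta> ^ l"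
  obtains k where "real j \<le> (base_shift \<beta> ^^ k) (phi \<beta> w) * real \<beta> ^ l"
    and "(base_shift \<beta> ^^ k) (phi \<beta> w) * real \<beta> ^ l \<le> real j + 1"
proof -
  from phi_cylinder[OF \<beta> j] obtain v where v: "length v = l" "set v \<subseteq> {0..<\<beta>}"
    "\<And>w. w \<in> words \<beta> \<Longrightarrow> \<forall>i<l. w i = v ! i \<Longrightarrow>
       real j \<le> phi \<beta> w * real \<beta> ^ l \<and> phi \<beta> w * real \<beta> ^ l \<le> real j + 1"
    by blast
  have "v \<in> factors w l" using factors_full[OF w compl] v by simp
  then obtain k where k: "v = map w [k..<k + l]" by (auto simp: factors_def)
  have "\<forall>i<l. w (i + k) = v ! i" by (simp add: k add.commute)
  then show ?thesis
    using v(3)[OF words_shift[OF w, of k]] that[of k] funpow_base_shift_phi[OF \<beta> w irr, of k] by auto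
qed

section \<open>Cylinders missing a union of short intervals\<close>

text \<open>An index in the set satisfies \<open>a * N - 1 \<le> j\<close> and
  \<open>j < (a + L) * N\<close>. This half-open range has length \<open>L * N + 1\<close> and so
  holds at most \<open>L * N + 2\<close> integers.\<close>

lemma card_cells_meeting_interval:
  fixes a L N :: real
  assumes "0 \<le> L" and N: "0 < N"
  shows "finite {j::nat. \<exists>t\<in>{a..<a + L}. real j \<le> t * N \<and> t * N \<le> real j + 1}" (is "finite ?B")
    and "real (card {j::nat. \<exists>t\<in>{a..<a + L}. real j \<le> t * N \<and> t * N \<le> real j + 1}) \<le> L * N + 2"
proof -
  let ?I = "{\<lceil>a * N\<rceil> - 1..\<lceil>(a + L) * N\<rceil> - 1}"
  have sub: "int ` ?B \<subseteq> ?I"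
  proof (rule image_subsetI)
    fix j assume "j \<in> ?B"
    then obtain t where t: "a \<le> t" "t < a + L" "real j \<le> t * N" "t * N \<le> real j + 1" by auto
    have "a * N \<le> t * N" "t * N < (a + L) * N" using t N by (auto intro: mult_right_mono)
    then have "a * N \<le> real j + 1" "real j < (a + L) * N" using t by linarith+
    then show "int j \<in> ?I" by (simp add: ceiling_le_iff) linarith
  qed
  then have "finite (int ` ?B)" by (rule finite_subset) simp
  then show "finite ?B" by (rule finite_imageD) simp
  \<comment> \<open>This keeps the difference of the ceilings nonnegative, so the cardinality of
    \<open>?I\<close> equals the integer expression without truncation at 0.\<close>
  have mono: "a * N \<le> (a + L) * N" using assms by (simp add: mult_right_mono)
  have "card ?B = card (int ` ?B)" by (simp add: card_image)
  also have "\<dots> \<le> card ?I" by (rule card_mono[OF _ sub]) simp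
  finally have "real (card ?B) \<le> real (card ?I)" by simp
  also have "\<dots> = real_of_int (\<lceil>(a + L) * N\<rceil> - \<lceil>a * N\<rceil> + 1)"
    using ceiling_mono[OF mono] by simp
  also have "\<dots> \<le> L * N + 2"
  proof -
    have "P \<le> a * N + L * N + 1 \<Longrightarrow> a * N \<le> Q \<Longrightarrow> P - Q + 1 \<le> L * N + 2" for P Q :: real
      by simp
    from this[OF _ le_of_int_ceiling] of_int_ceiling_le_add_one[of "(a + L) * N"] show ?thesis
      by (simp add: distrib_right)
  qed
  finally show "real (card ?B) \<le> L * N + 2" .
qed

text \<open>Counting: the intervals together meet at most \<open>sum L A * M + 2 * card A\<close>
  closed cells of width \<open>1 / M\<close>, which is fewer than the \<open>M\<close>
  available.\<close>

lemma exists_cell_missing_intervals: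
  fixes a L :: "nat \<Rightarrow> real" and M :: nat
  assumes "finite A" and L: "\<And>i. i \<in> A \<Longrightarrow> 0 \<le> L i"
    and lt: "sum L A * real M + 2 * real (card A) < real M"
  shows "\<exists>j<M. \<forall>t\<in>(\<Union>i\<in>A. {a i..<a i + L i}). \<not> (real j \<le> t * real M \<and> t * real M \<le> real j + 1)"
proof (rule ccontr)
  define B where "B i = {j::nat. \<exists>t\<in>{a i..<a i + L i}. real j \<le> t * real M \<and> t * real M \<le> real j + 1}" for i
  assume "\<not> ?thesis"
  then have sub: "{..<M} \<subseteq> (\<Union>i\<in>A. B i)" unfolding B_def by fastforce
  have M: "0 < real M"
    using lt by (cases "M = 0") auto
  have B: "finite (B i)" "real (card (B i)) \<le> L i * real M + 2" if "i \<in> A" for i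
    using card_cells_meeting_interval[OF L[OF that] M] by (simp_all add: B_def)
  have "M \<le> card (\<Union>i\<in>A. B i)"
    using card_mono[OF _ sub] B \<open>finite A\<close> by simp
  also have "\<dots> \<le> (\<Sum>i\<in>A. card (B i))" by (rule card_UN_le[OF \<open>finite A\<close>])
  finally have "real M \<le> (\<Sum>i\<in>A. real (card (B i)))" by (metis of_nat_le_iff of_nat_sum)
  also have "\<dots> \<le> (\<Sum>i\<in>A. L i * real M + 2)" using B by (intro sum_mono) auto
  also have "\<dots> = sum L A * real M + 2 * real (card A)"
    by (simp add: sum.distrib sum_distrib_right)
  finally show False using lt by simp
qed

lemma ell_bound:
  assumes "\<beta> \<ge> 2"
  shows "2 / real \<beta> ^ ell \<beta> n < (1 - 1 / real \<beta>) / (real n + 1)"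
  unfolding ell_def
proof (rule LeastI_ex)
  have pos: "0 < (1 - 1 / real \<beta>) / (real n + 1)" using assms by simp
  obtain k where "(1 / real \<beta>) ^ k < (1 - 1 / real \<beta>) / (real n + 1) / 2"
    using real_arch_pow_inv[of "(1 - 1 / real \<beta>) / (real n + 1) / 2" "1 / real \<beta>"] pos assms by auto
  then show "\<exists>k. 2 / real \<beta> ^ k < (1 - 1 / real \<beta>) / (real n + 1)"
    by (intro exI[of _ k]) (simp add: power_divide del: divide_divide_eq_left)
qed

section \<open>Backward orbits of the breakpoints\<close>

text \<open>\<open>T ^^ k\<close> undoes \<open>f ^^ k\<close>, so each \<open>k\<close> contributes
  at most the point \<open>(T ^^ k) q\<close>. If \<open>(T ^^ k0) q\<close> is outside the image,
  no \<open>k > k0\<close> contributes, since a preimage would exhibit \<open>(T ^^ k0) q\<close> as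
  a value of \<open>f\<close>.\<close>

lemma finite_backward_orbit:
  fixes f T :: "'a \<Rightarrow> 'a"
  assumes maps: "\<And>t. t \<in> I \<Longrightarrow> f t \<in> I" and inv: "\<And>t. t \<in> I \<Longrightarrow> T (f t) = t"
    and alt: "finite (range (\<lambda>k. (T ^^ k) q)) \<or> (\<exists>k. (T ^^ k) q \<notin> f ` I)"
  shows "finite {t \<in> I. \<exists>k. (f ^^ k) t = q}"
proof -
  have it: "(f ^^ k) t \<in> I" if "t \<in> I" for t k
    using that maps by (induction k) auto
  have Tk: "(T ^^ k) ((f ^^ (k + m)) t) = (f ^^ m) t" if "t \<in> I" for t k m
  proof (induction k)
    case (Suc k)
    have "(T ^^ Suc k) ((f ^^ (Suc k + m)) t) = (T ^^ k) (T (f ((f ^^ (k + m)) t)))"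
      by (simp add: funpow_swap1)
    with Suc inv it that show ?case by simp
  qed simp
  have TkI: "(T ^^ k) ((f ^^ k) t) = t" if "t \<in> I" for t k
    using Tk[OF that, of k 0] by simp
  have sub: "{t \<in> I. \<exists>k. (f ^^ k) t = q} \<subseteq> range (\<lambda>k. (T ^^ k) q)"
  proof
    fix t assume "t \<in> {t \<in> I. \<exists>k. (f ^^ k) t = q}"
    then obtain k where "t \<in> I" "(f ^^ k) t = q" by blast
    then have "t = (T ^^ k) q" using TkI by metis
    then show "t \<in> range (\<lambda>k. (T ^^ k) q)" by blast
  qed
  from alt show ?thesis
  proof
    assume "finite (range (\<lambda>k. (T ^^ k) q))"
    with sub show ?thesis by (rule finite_subset)
  next
    assume "\<exists>k. (T ^^ k) q \<notin> f ` I"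
    then obtain k0 where k0: "(T ^^ k0) q \<notin> f ` I" by blast
    have "{t \<in> I. \<exists>k. (f ^^ k) t = q} \<subseteq> (\<lambda>k. (T ^^ k) q) ` {..k0}"
    proof
      fix t assume "t \<in> {t \<in> I. \<exists>k. (f ^^ k) t = q}"
      then obtain k where t: "t \<in> I" and q: "(f ^^ k) t = q" by blast
      have "k \<le> k0"
      proof (rule ccontr)
        assume "\<not> k \<le> k0"
        then obtain m where m: "k = k0 + Suc m" by (metis add_Suc_right less_imp_Suc_add not_le)
        have "(T ^^ k0) q = (f ^^ Suc m) t" using Tk[OF t, of k0 "Suc m"] q m by simp
        then show False using k0 it[OF t, of m] by auto
      qed
      moreover have "t = (T ^^ k) q" using TkI[OF t] q by metis
      ultimately show "t \<in> (\<lambda>k. (T ^^ k) q) ` {..k0}" by blast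
    qed
    then show ?thesis by (rule finite_subset) simp
  qed
qed

theorem theorem2p1:
  fixes \<beta> n :: nat
    and x :: "nat \<Rightarrow> real"
    and \<alpha> :: "nat \<Rightarrow> nat"
    and f :: "real \<Rightarrow> real"
  assumes "\<beta> \<ge> 2" and "n \<ge> 2"
    and "x 0 = 0" and "x n = 1"
    and "\<And>i. i < n \<Longrightarrow> x i < x (i + 1)"
    and "\<And>i. i \<in> {1..n - 1} \<Longrightarrow> x i \<in> \<rat> \<or> x i \<in> S \<beta> n"
    and "\<And>i. i \<in> {1..n} \<Longrightarrow> \<alpha> i \<in> {1..\<beta>}"
    and "\<And>i t. i \<in> {1..n} \<Longrightarrow> t \<in> {x (i - 1)..<x i} \<Longrightarrow>
           f t = 1 / real \<beta> * t + (real (\<alpha> i) - 1) / real \<beta>"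
  shows "finite (global_attractor f)"
proof -
  note x0 = assms(3) and xn = assms(4) and xlt = assms(5) and xQ = assms(6)
    and \<alpha> = assms(7) and f = assms(8)
  have \<beta>: "\<beta> \<ge> 2" by fact
  let ?I = "{0..<1::real}"
  have piece: "\<exists>i\<in>{1..n}. t \<in> {x (i - 1)..<x i}" if t: "t \<in> ?I" for t
  proof -
    define i where "i = (LEAST i. t < x i)"
    have i: "t < x i" "i \<le> n"
      unfolding i_def using t xn by (auto intro: LeastI[of _ n] Least_le)
    have "i \<noteq> 0" using i(1) t x0 by (intro notI) auto
    then have "\<not> t < x (i - 1)" unfolding i_def by (intro not_less_Least) simp
    with i \<open>i \<noteq> 0\<close> show ?thesis by (intro bexI[of _ i]) auto
  qed
  have maps: "f t \<in> ?I" and inv: "base_shift \<beta> (f t) = t" if t: "t \<in> ?I" for t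
  proof -
    obtain i where i: "i \<in> {1..n}" "t \<in> {x (i - 1)..<x i}" using piece[OF t] by blast
    have a: "1 \<le> \<alpha> i" "real (\<alpha> i) \<le> real \<beta>" using \<alpha>[OF i(1)] by auto
    \<comment> \<open>\<open>f\<close> prepends the digit \<open>\<alpha> i - 1\<close>; the
      subtraction of natural numbers is exact because \<open>1 \<le> \<alpha> i\<close>.\<close>
    have eq: "real \<beta> * f t = t + of_nat (\<alpha> i - 1)"
      using f[OF i] \<beta> a by (simp add: field_simps of_nat_diff)
    have "0 \<le> real \<beta> * f t" "real \<beta> * f t < real \<beta> * 1"
      using eq a t by (auto simp: of_nat_diff)
    then show "f t \<in> ?I" using \<beta> by (simp add: zero_le_mult_iff)
    show "base_shift \<beta> (f t) = t"
      unfolding base_shift_def eq using t by (simp add: frac_def floor_unique)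
  qed
  define l where "l = ell \<beta> n"
  \<comment> \<open>Left end and, below, length of the image of the \<open>i\<close>-th
    piece.\<close>
  define a where "a i = x (i - 1) / real \<beta> + (real (\<alpha> i) - 1) / real \<beta>" for i
  define L where "L i = (x i - x (i - 1)) / real \<beta>" for i
  have image: "f ` ?I \<subseteq> (\<Union>i\<in>{1..n}. {a i..<a i + L i})"
  proof (rule image_subsetI)
    fix t assume "t \<in> ?I"
    then obtain i where i: "i \<in> {1..n}" "t \<in> {x (i - 1)..<x i}" using piece by blast
    have "f t \<in> {a i..<a i + L i}"
      using f[OF i] i \<beta> by (auto simp: a_def L_def diff_divide_distrib divide_right_mono divide_strict_right_mono)
    with i show "f t \<in> (\<Union>i\<in>{1..n}. {a i..<a i + L i})" by blast
  qed
  have "\<exists>j<\<beta> ^ l. \<forall>t\<in>(\<Union>i\<in>{1..n}. {a i..<a i + L i}).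
      \<not> (real j \<le> t * real (\<beta> ^ l) \<and> t * real (\<beta> ^ l) \<le> real j + 1)"
  proof (rule exists_cell_missing_intervals)
    show "0 \<le> L i" if "i \<in> {1..n}" for i
    proof -
      have "i - 1 < n" "i - 1 + 1 = i" using that by auto
      with xlt[of "i - 1"] have "x (i - 1) < x i" by simp
      then show ?thesis by (simp add: L_def)
    qed
    have "sum L {1..n} = (\<Sum>i<n. x (Suc i) - x i) / real \<beta>"
      unfolding L_def sum_divide_distrib[symmetric]
      by (simp add: sum.atLeast1_atMost_eq)
    then have L: "sum L {1..n} = 1 / real \<beta>"
      by (simp add: sum_lessThan_telescope x0 xn)
    \<comment> \<open>By the choice of \<open>ell\<close>. The bound dominates the
      \<open>2 * n\<close> boundary cells that the \<open>n\<close> image intervals may add to their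
      share \<open>1 / \<beta>\<close> of all cells.\<close>
    have "2 * (real n + 1) < (1 - 1 / real \<beta>) * real \<beta> ^ l"
    proof -
      have "2 / B < c / d \<Longrightarrow> 0 < B \<Longrightarrow> 0 < d \<Longrightarrow> 2 * d < c * B" for B c d :: real
        by (simp add: field_simps)
      from this[OF ell_bound[OF \<beta>, of n]] show ?thesis using \<beta> unfolding l_def by simp
    qed
    then show "sum L {1..n} * real (\<beta> ^ l) + 2 * real (card {1..n}) < real (\<beta> ^ l)"
      unfolding L by (simp add: algebra_simps)
  qed simp
  then obtain j where j: "j < \<beta> ^ l"
    "\<And>t. t \<in> f ` ?I \<Longrightarrow> \<not> (real j \<le> t * real \<beta> ^ l \<and> t * real \<beta> ^ l \<le> real j + 1)"
    using image by (metis of_nat_power subsetD)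
  \<comment> \<open>The case \<open>k = 0\<close> puts the interior breakpoints themselves into
    \<open>Q\<close>. The points 0 and 1 are left out, as no \<open>{t<..u}\<close> with
    \<open>0 \<le> t\<close> and \<open>u < 1\<close> contains them.\<close>
  define Q where "Q = (\<Union>i\<in>{1..n - 1}. {t \<in> ?I. \<exists>k. (f ^^ k) t = x i})"
  have "finite {t \<in> ?I. \<exists>k. (f ^^ k) t = x i}" if i: "i \<in> {1..n - 1}" for i
  proof (rule finite_backward_orbit[OF maps inv])
    show "finite (range (\<lambda>k. (base_shift \<beta> ^^ k) (x i))) \<or> (\<exists>k. (base_shift \<beta> ^^ k) (x i) \<notin> f ` ?I)"
    proof (cases "x i \<in> \<rat>")
      case True
      then show ?thesis using funpow_base_shift_rational_finite by blast
    next
      case False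
      then have "x i \<in> S \<beta> n" using xQ[OF i] by blast
      then obtain w where w: "w \<in> words \<beta>" "complexity w l = \<beta> ^ l" "x i = phi \<beta> w"
        by (auto simp: S_def l_def)
      \<comment> \<open>The shift orbit of an irrational breakpoint enters the closed cell
        \<open>j\<close>, which the image of \<open>f\<close> misses.\<close>
      obtain k where "real j \<le> (base_shift \<beta> ^^ k) (x i) * real \<beta> ^ l"
        "(base_shift \<beta> ^^ k) (x i) * real \<beta> ^ l \<le> real j + 1"
        using shift_visits_cylinder[OF \<beta> w(1) _ w(2) j(1)] False w(3) by metis
      then show ?thesis using j(2) by blast
    qed
  qed
  then have finQ: "finite Q" by (simp add: Q_def)
  show ?thesis
  proof (rule finite_global_attractor_if_backward_invariant[where Q = Q and r = "1 / real \<beta>"])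
    show "t \<in> Q" if t: "t \<in> ?I" and ft: "f t \<in> Q" for t
    proof -
      from ft obtain i k where ik: "i \<in> {1..n - 1}" "(f ^^ k) (f t) = x i"
        unfolding Q_def by blast
      then have "(f ^^ Suc k) t = x i" by (simp add: funpow_swap1)
      with t ik(1) show ?thesis unfolding Q_def by blast
    qed
    show "\<exists>b. \<forall>z\<in>{t..u}. f z = 1 / real \<beta> * z + b"
      if tu: "0 \<le> t" "t < u" "u < 1" and Q: "{t<..u} \<inter> Q = {}" for t u
    proof -
      obtain i where i: "i \<in> {1..n}" "t \<in> {x (i - 1)..<x i}" using piece[of t] tu by auto
      \<comment> \<open>Otherwise \<open>x i\<close> would be a point of \<open>Q\<close> in
        \<open>{t<..u}\<close>; the last breakpoint is excluded because
        \<open>u < 1\<close>.\<close>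
      have "u < x i"
      proof (rule ccontr)
        assume u: "\<not> u < x i"
        then have "i \<noteq> n" using xn tu by auto
        then have "i \<in> {1..n - 1}" using i by auto
        moreover have "x i \<in> ?I" "(f ^^ 0) (x i) = x i" using u tu i by auto
        ultimately have "x i \<in> Q" unfolding Q_def by blast
        moreover have "x i \<in> {t<..u}" using u i by simp
        ultimately show False using Q by blast
      qed
      then have "\<forall>z\<in>{t..u}. f z = 1 / real \<beta> * z + (real (\<alpha> i) - 1) / real \<beta>"
        using f[OF i(1)] i(2) by auto
      then show ?thesis by blast
    qed
  qed (use maps finQ \<beta> in auto)
qed

end
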